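(* Let $(N,M)\in\mathcal{R}_{11}$. Then there are functions $f\in\mathcal{H}_N$ and $g\in\mathcal{H}_{K_{N,M}}$ such that $$N(z,\lambda,w,\mu)=\overline{f(w,\mu)}f(z,\lambda)\quad\text{and}\quad K_{N,M}(z,\lambda,w,\mu)=\overline{g(w,\mu)}g(z,\lambda)$$ for all $z,\lambda,w,\mu\in\mathbb{D}$, and a function $\Xi\in\mathcal{S}^{2\times2}$ such that $$\Xi(\lambda)\begin{pmatrix}1\\ z f(z,\lambda)\end{pmatrix}=\begin{pmatrix}g(z,\lambda)\\ f(z,\lambda)\end{pmatrix}$$ for all $z,\lambda\in\mathbb{D}$.
   Context: $\mathbb{D}$ is the open unit disc. A kernel on $\mathbb{D}^2$ is a function $k:\mathbb{D}^2\times\mathbb{D}^2\to\mathbb{C}$, written $k(z,\lambda,w,\mu)$ with $(z,\lambda),(w,\mu)\in\mathbb{D}^2$, that is positive semidefinite (for all finite families of points $p_i\in\mathbb{D}^2$ and $c_i\in\mathbb{C}$, $\sum_{i,j}c_i\overline{c_j}\,k(p_i,p_j)\ge0$). It is analytic if it is analytic in $(z,\lambda)$ and conjugate-analytic in $(w,\mu)$. $\mathcal{H}_k$ is the unique Hilbert function space on $\mathbb{D}^2$ having $k$ as its reproducing kernel; the rank of $k$ is $\dim\mathcal{H}_k$. For analytic kernels $N,M$ on $\mathbb{D}^2$, $K_{N,M}(z,\lambda,w,\mu)=1-(1-\overline{w}z)N(z,\lambda,w,\mu)-(1-\overline{\mu}\lambda)M(z,\lambda,w,\mu)$. $\mathcal{R}_{11}$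 is the set of pairs $(N,M)$ such that $N$, $M$, $K_{N,M}$ are analytic kernels on $\mathbb{D}^2$ and both $N$ and $K_{N,M}$ are of rank $1$. $\mathcal{S}^{2\times2}$ is the set of analytic $2\times2$ matrix functions $F$ on $\mathbb{D}$ with $\|F(\lambda)\|\le1$ for all $\lambda\in\mathbb{D}$. *)

theory Defs
  imports "HOL-Analysis.Analysis" "HOL-Library.Function_Algebras"
begin

section \<open>Hilbert function spaces and reproducing kernels\<close>

global_interpretation cfun:
  vector_space "\<lambda>(c::complex) (f::'a \<Rightarrow> complex). (\<lambda>x. c * f x)"
  by unfold_locales (auto simp: fun_eq_iff algebra_simps)

text \<open>
  A complex function on a set \<open>X\<close> is represented by a total function that vanishes outside \<open>X\<close>,
  so that equality of functions on \<open>X\<close> is equality in HOL.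
  The inner product is linear in its first argument.
\<close>

locale hilbert_function_space =
  fixes X :: "'a set"
    and H :: "('a \<Rightarrow> complex) set"
    and ip :: "('a \<Rightarrow> complex) \<Rightarrow> ('a \<Rightarrow> complex) \<Rightarrow> complex"
  assumes subspace: "cfun.subspace H"
    and vanishes: "\<And>f x. f \<in> H \<Longrightarrow> x \<notin> X \<Longrightarrow> f x = 0"
    and ip_add: "\<And>f g h. f \<in> H \<Longrightarrow> g \<in> H \<Longrightarrow> h \<in> H \<Longrightarrow> ip (f + g) h = ip f h + ip g h"
    and ip_scale: "\<And>c f g. f \<in> H \<Longrightarrow> g \<in> H \<Longrightarrow> ip (\<lambda>x. c * f x) g = c * ip f g"
    and ip_cnj: "\<And>f g. f \<in> H \<Longrightarrow> g \<in> H \<Longrightarrow> ip g f = cnj (ip f g)"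
    and ip_pos: "\<And>f. f \<in> H \<Longrightarrow> f \<noteq> 0 \<Longrightarrow> 0 < Re (ip f f)"
    and complete: "\<And>s. (\<And>n. s n \<in> H) \<Longrightarrow>
        (\<And>e. 0 < e \<Longrightarrow> \<exists>n0. \<forall>m\<ge>n0. \<forall>n\<ge>n0. sqrt (Re (ip (s m - s n) (s m - s n))) < e) \<Longrightarrow>
        \<exists>f\<in>H. (\<lambda>n. sqrt (Re (ip (s n - f) (s n - f)))) \<longlonglongrightarrow> 0"
    and bounded_eval: "\<And>x. x \<in> X \<Longrightarrow> \<exists>C. \<forall>f\<in>H. cmod (f x) \<le> C * sqrt (Re (ip f f))"

definition has_reproducing_kernel ::
    "'a set \<Rightarrow> ('a \<Rightarrow> complex) set \<Rightarrow> (('a \<Rightarrow> complex) \<Rightarrow> ('a \<Rightarrow> complex) \<Rightarrow> complex)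
      \<Rightarrow> ('a \<Rightarrow> 'a \<Rightarrow> complex) \<Rightarrow> bool" where
  "has_reproducing_kernel X H ip k \<longleftrightarrow>
     (\<forall>q\<in>X. (\<lambda>p. if p \<in> X then k p q else 0) \<in> H \<and>
        (\<forall>f\<in>H. f q = ip f (\<lambda>p. if p \<in> X then k p q else 0)))"

text \<open>
  The underlying set of the Hilbert function space on \<open>X\<close> with reproducing kernel \<open>k\<close>.  For a
  kernel \<open>k\<close> that space exists and is unique (Moore, Aronszajn), so the union below is over a
  single space.
\<close>

definition rkhs :: "'a set \<Rightarrow> ('a \<Rightarrow> 'a \<Rightarrow> complex) \<Rightarrow> ('a \<Rightarrow> complex) set" where
  "rkhs X k = \<Union>{H. \<exists>ip. hilbert_function_space X H ip \<and> has_reproducing_kernel X H ip k}"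

text \<open>The library's \<open>dim\<close> is \<open>0\<close> on infinite-dimensional spaces, hence the case distinction.\<close>

definition kernel_rank :: "'a set \<Rightarrow> ('a \<Rightarrow> 'a \<Rightarrow> complex) \<Rightarrow> enat" where
  "kernel_rank X k =
     (if \<exists>B. finite B \<and> rkhs X k \<subseteq> cfun.span B then enat (cfun.dim (rkhs X k)) else \<infinity>)"

definition is_kernel :: "'a set \<Rightarrow> ('a \<Rightarrow> 'a \<Rightarrow> complex) \<Rightarrow> bool" where
  "is_kernel X k \<longleftrightarrow>
     (\<forall>n::nat. \<forall>p. \<forall>c. (\<forall>i<n. p i \<in> X) \<longrightarrow>
        (\<Sum>i<n. \<Sum>j<n. c i * cnj (c j) * k (p i) (p j)) \<in> \<real>\<^sub>\<ge>\<^sub>0)"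


section \<open>Analytic kernels on the bidisc\<close>

abbreviation disc :: "complex set" where
  "disc \<equiv> ball 0 1"

abbreviation bidisc :: "(complex \<times> complex) set" where
  "bidisc \<equiv> disc \<times> disc"

text \<open>Analyticity in two variables: complex Frechet differentiability on an open set.\<close>

definition analytic2_on :: "(complex \<times> complex \<Rightarrow> complex) \<Rightarrow> (complex \<times> complex) set \<Rightarrow> bool" where
  "analytic2_on f S \<longleftrightarrow>
     (\<forall>p\<in>S. \<exists>a b. (f has_derivative (\<lambda>(u, v). a * u + b * v)) (at p))"

text \<open>The points of the bidisc are written \<open>(z, l)\<close> and \<open>(w, m)\<close>, with \<open>l\<close> and \<open>m\<close> for lambda and mu.\<close>

type_synonym kernel2 = "complex \<times> complex \<Rightarrow> complex \<times> complex \<Rightarrow> complex"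

definition analytic_kernel :: "kernel2 \<Rightarrow> bool" where
  "analytic_kernel k \<longleftrightarrow> is_kernel bidisc k \<and>
     (\<forall>q\<in>bidisc. analytic2_on (\<lambda>p. k p q) bidisc) \<and>
     (\<forall>p\<in>bidisc. analytic2_on (\<lambda>q. cnj (k p q)) bidisc)"

definition K_kernel :: "kernel2 \<Rightarrow> kernel2 \<Rightarrow> kernel2" where
  "K_kernel N M = (\<lambda>(z, l) (w, m).
     1 - (1 - cnj w * z) * N (z, l) (w, m) - (1 - cnj m * l) * M (z, l) (w, m))"

definition R11 :: "(kernel2 \<times> kernel2) set" where
  "R11 = {(N, M). analytic_kernel N \<and> analytic_kernel M \<and> analytic_kernel (K_kernel N M) \<and>
     kernel_rank bidisc N = 1 \<and> kernel_rank bidisc (K_kernel N M) = 1}"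


section \<open>The matricial Schur class\<close>

definition schur22 :: "(complex \<Rightarrow> complex^2^2) set" where
  "schur22 = {F. (\<forall>i j. (\<lambda>l. F l $ i $ j) holomorphic_on disc) \<and>
     (\<forall>l\<in>disc. onorm (\<lambda>v. F l *v v) \<le> 1)}"

end

theory Submission
  imports Defs "HOL-Complex_Analysis.Complex_Analysis"
begin

no_notation fps_nth (infixl \<open>$\<close> 75)

text \<open>
  A rank-one kernel is \<open>f p * cnj (f q)\<close>.  With \<open>u = (1, z f)\<close> and \<open>v = (g, f)\<close>, the definition of
  \<open>K_kernel\<close> says \<open>\<langle>u p, u q\<rangle> - \<langle>v p, v q\<rangle> = (1 - cnj m * l) M p q\<close>.  On a slice where \<open>l = m\<close> is
  fixed, positivity of \<open>M\<close> makes \<open>u (z, l) \<mapsto> v (z, l)\<close> extend to a linear contraction on the span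
  of the vectors \<open>u (z, l)\<close>.  Choose \<open>z0 \<noteq> 0\<close> for which \<open>f (z0, \<cdot>)\<close> is not identically zero.
  Off the zeros of \<open>f (z0, \<cdot>)\<close> the vectors \<open>u (0, l)\<close> and \<open>u (z0, l)\<close> span \<open>\<complex>\<^sup>2\<close>, so the contraction
  is a unique matrix, given by difference quotients that are holomorphic in \<open>l\<close> and bounded;
  its singularities are therefore removable, and contractivity and the functional equation
  persist at them by continuity.
\<close>

section \<open>Rank-one kernels\<close>

lemma dim_eq_1_obtains:
  assumes "cfun.dim V = 1"
  obtains b where "b \<in> V" "b \<noteq> 0" "V \<subseteq> cfun.span {b}"
proof -
  obtain B where B: "B \<subseteq> V" "cfun.independent B" "V \<subseteq> cfun.span B" "card B = cfun.dim V"
    by (rule cfun.basis_exists)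
  then obtain b where b: "B = {b}"
    using assms by (auto simp: card_1_singleton_iff)
  have "b \<noteq> 0"
    using B(2) b cfun.dependent_zero by auto
  then show thesis
    using that B b by auto
qed

text \<open>If \<open>b\<close> spans the space and \<open>r = ip b b\<close>, each kernel section
  at \<open>q\<close> is some \<open>c * b\<close>. The reproducing property applied to
  \<open>b\<close> gives \<open>b q = cnj c * r\<close>, which determines \<open>c\<close>; dividing
  \<open>b\<close> by \<open>sqrt r\<close> absorbs the constant.\<close>

lemma kernel_rank_1_imp_factor:
  assumes "kernel_rank X k = 1"
  obtains f where "f \<in> rkhs X k" "\<And>p q. p \<in> X \<Longrightarrow> q \<in> X \<Longrightarrow> k p q = f p * cnj (f q)"
    "\<exists>p\<in>X. f p \<noteq> 0"
proof -
  have "cfun.dim (rkhs X k) = 1"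
    using assms by (auto simp: kernel_rank_def one_enat_def split: if_splits)
  then obtain b where b: "b \<in> rkhs X k" "b \<noteq> 0" "rkhs X k \<subseteq> cfun.span {b}"
    by (rule dim_eq_1_obtains)
  from b(1) obtain H ip where bH: "b \<in> H" and H: "hilbert_function_space X H ip"
    and rk: "has_reproducing_kernel X H ip k"
    unfolding rkhs_def by blast
  interpret hilbert_function_space X H ip by (rule H)
  have HR: "H \<subseteq> rkhs X k"
    unfolding rkhs_def using H rk by blast
  define r where "r = Re (ip b b)"
  have r: "r > 0"
    unfolding r_def using ip_pos bH b(2) by blast
  have "ip b b = cnj (ip b b)"
    using ip_cnj[OF bH bH] .
  then have ipb: "ip b b = of_real r"
    unfolding r_def by (simp add: complex_eq_iff)
  have k_eq: "k p q = b p * cnj (b q) / of_real r" if p: "p \<in> X" and q: "q \<in> X" for p q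
  proof -
    let ?kq = "\<lambda>p. if p \<in> X then k p q else 0"
    have kq: "?kq \<in> H" and bq: "b q = ip b ?kq"
      using rk q bH unfolding has_reproducing_kernel_def by auto
    then obtain c where c: "?kq = (\<lambda>x. c * b x)"
      using HR b(3) by (auto simp: cfun.span_singleton)
    have "ip ?kq b = c * of_real r"
      unfolding c using ip_scale[OF bH bH] ipb by simp
    then have "b q = cnj c * of_real r"
      using bq ip_cnj[OF kq bH] by simp
    moreover have "k p q = c * b p"
      using fun_cong[OF c, of p] p by simp
    ultimately show ?thesis
      using r by simp
  qed
  define f where "f = (\<lambda>x. of_real (1 / sqrt r) * b x)"
  have "f \<in> H"
    unfolding f_def using cfun.subspace_scale[OF subspace bH] .
  moreover have "k p q = f p * cnj (f q)" if "p \<in> X" "q \<in> X" for p q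
  proof -
    have "complex_of_real (sqrt r) * of_real (sqrt r) = of_real r"
      using r by (simp flip: of_real_mult)
    then show ?thesis
      using k_eq[OF that] by (simp add: f_def)
  qed
  \<comment> \<open>Elements of \<open>H\<close> vanish off \<open>X\<close>, so the nonzero
    function \<open>b\<close> is nonzero at a point of \<open>X\<close>.\<close>
  moreover have "\<exists>p\<in>X. f p \<noteq> 0"
    using b(2) r vanishes[OF bH] by (auto simp: f_def fun_eq_iff)
  ultimately show thesis
    using that HR by blast
qed

lemma analytic2_on_holomorphic_slices:
  assumes "analytic2_on F (S \<times> T)" "w \<in> S" "m \<in> T"
  shows "(\<lambda>z. F (z, m)) holomorphic_on S" "(\<lambda>l. F (w, l)) holomorphic_on T"
proof -
  have *: "(\<lambda>z. F (z, l)) field_differentiable at z"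
       "(\<lambda>l. F (z, l)) field_differentiable at l" if "z \<in> S" "l \<in> T" for z l
  proof -
    from assms(1) that obtain a b where
      D: "(F has_derivative (\<lambda>(u, v). a * u + b * v)) (at (z, l))"
      unfolding analytic2_on_def by blast
    have "((\<lambda>z. (z, l)) has_derivative (\<lambda>u. (u, 0))) (at z)"
         "((\<lambda>l. (z, l)) has_derivative (\<lambda>v. (0, v))) (at l)"
      by (intro derivative_intros)+
    from this[THEN has_derivative_compose, OF D]
    have "((\<lambda>z. F (z, l)) has_derivative (\<lambda>u. a * u)) (at z)"
         "((\<lambda>l. F (z, l)) has_derivative (\<lambda>v. b * v)) (at l)"
      by simp_all
    then show "(\<lambda>z. F (z, l)) field_differentiable at z"
       "(\<lambda>l. F (z, l)) field_differentiable at l"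
      by (auto simp: field_differentiable_def has_field_derivative_def)
  qed
  then show "(\<lambda>z. F (z, m)) holomorphic_on S" "(\<lambda>l. F (w, l)) holomorphic_on T"
    using assms(2,3) by (auto simp: holomorphic_on_def intro: field_differentiable_at_within)
qed

text \<open>At a point \<open>q\<close> with \<open>f q \<noteq> 0\<close>, the factor is
  \<open>k p q / cnj (f q)\<close>, so \<open>f\<close> inherits analyticity in each variable from
  the kernel section at \<open>q\<close>.\<close>

lemma rank_1_analytic_kernel:
  assumes "analytic_kernel k" "kernel_rank bidisc k = 1"
  obtains f where "f \<in> rkhs bidisc k"
    "\<And>p q. p \<in> bidisc \<Longrightarrow> q \<in> bidisc \<Longrightarrow> k p q = f p * cnj (f q)"
    "\<exists>p\<in>bidisc. f p \<noteq> 0"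
    "\<And>l. l \<in> disc \<Longrightarrow> (\<lambda>z. f (z, l)) holomorphic_on disc"
    "\<And>z. z \<in> disc \<Longrightarrow> (\<lambda>l. f (z, l)) holomorphic_on disc"
proof -
  obtain f where f: "f \<in> rkhs bidisc k"
    "\<And>p q. p \<in> bidisc \<Longrightarrow> q \<in> bidisc \<Longrightarrow> k p q = f p * cnj (f q)" "\<exists>p\<in>bidisc. f p \<noteq> 0"
    using kernel_rank_1_imp_factor[OF assms(2)] by blast
  from f(3) obtain q where q: "q \<in> bidisc" "f q \<noteq> 0" by blast
  have an: "analytic2_on (\<lambda>p. k p q) bidisc"
    using assms(1) q(1) unfolding analytic_kernel_def by blast
  have eq: "f p = k p q / cnj (f q)" if "p \<in> bidisc" for p
    using f(2)[OF that q(1)] q(2) by simp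
  have "(\<lambda>z. f (z, l)) holomorphic_on disc" if "l \<in> disc" for l
  proof -
    have "(\<lambda>z. k (z, l) q / cnj (f q)) holomorphic_on disc"
      using analytic2_on_holomorphic_slices(1)[OF an that that] q(2)
      by (intro holomorphic_intros) auto
    then show ?thesis
      by (rule holomorphic_transform) (use that eq in auto)
  qed
  moreover have "(\<lambda>l. f (z, l)) holomorphic_on disc" if "z \<in> disc" for z
  proof -
    have "(\<lambda>l. k (z, l) q / cnj (f q)) holomorphic_on disc"
      using analytic2_on_holomorphic_slices(2)[OF an that that] q(2)
      by (intro holomorphic_intros) auto
    then show ?thesis
      by (rule holomorphic_transform) (use that eq in auto)
  qed
  ultimately show thesis
    using that f by blast
qed

section \<open>Bounded quotients of holomorphic functions\<close>

text \<open>The zeros of \<open>d\<close> are isolated by the identity theorem, and off them the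
  quotient is bounded by 1. Riemann's theorem removes every singularity, and
  \<open>remove_sings\<close> collects the local extensions into one function.\<close>

lemma bounded_quotient_holomorphic:
  assumes S: "open S" "connected S" and hol: "f holomorphic_on S" "d holomorphic_on S"
    and le: "\<And>z. z \<in> S \<Longrightarrow> cmod (f z) \<le> cmod (d z)" and nz: "a \<in> S" "d a \<noteq> 0"
  obtains h where "h holomorphic_on S" "\<And>z. z \<in> S \<Longrightarrow> f z = d z * h z"
proof
  let ?q = "\<lambda>z. f z / d z"
  have "remove_sings ?q analytic_on {z}" if z: "z \<in> S" for z
  proof -
    have ev: "\<forall>\<^sub>F w in at z. d w \<noteq> 0 \<and> w \<in> S"
      using non_zero_neighbour_alt[OF hol(2) S z nz] .
    then obtain e where e: "e > 0" "\<And>w. w \<in> ball z e - {z} \<Longrightarrow> d w \<noteq> 0 \<and> w \<in> S"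
      unfolding eventually_at by (auto simp: dist_commute)
    have sub: "ball z e - {z} \<subseteq> S" using e(2) by blast
    have hq: "?q holomorphic_on ball z e - {z}"
      using e(2) holomorphic_on_subset[OF hol(1) sub] holomorphic_on_subset[OF hol(2) sub]
      by (intro holomorphic_intros) auto
    have "\<forall>\<^sub>F w in at z. cmod (?q w) \<le> 1"
      using ev by eventually_elim (use le in \<open>auto simp: norm_divide divide_simps\<close>)
    then obtain g where g: "g holomorphic_on ball z e" "\<forall>w\<in>ball z e - {z}. g w = ?q w"
      using holomorphic_on_extend_bounded[OF hq] e(1) by auto
    have "isCont g z"
      using g(1) e(1) by (meson centre_in_ball continuous_on_eq_continuous_at
          holomorphic_on_imp_continuous_on open_ball)
    then have "g \<midarrow>z\<rightarrow> g z" by (simp add: isCont_def)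
    then have "?q \<midarrow>z\<rightarrow> g z"
      by (rule Lim_transform_within_open[of _ _ _ _ "ball z e"]) (use g(2) e(1) in auto)
    moreover have "isolated_singularity_at ?q z"
      unfolding isolated_singularity_at_def
      using hq e(1) analytic_on_open[of "ball z e - {z}" ?q] by auto
    ultimately show ?thesis
      by (intro remove_sings_analytic_at)
  qed
  then have "remove_sings ?q analytic_on S"
    using analytic_on_analytic_at by blast
  then show h: "remove_sings ?q holomorphic_on S"
    by (rule analytic_imp_holomorphic)
  show "f z = d z * remove_sings ?q z" if "z \<in> S" for z
  proof (cases "d z = 0")
    \<comment> \<open>At a zero of \<open>d\<close> the bound forces \<open>f z = 0\<close>,
      whatever the value of the extension.\<close>
    case True
    with le[OF that] show ?thesis by simp
  next
    case False
    have "f analytic_on {z}" "d analytic_on {z}"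
      using hol S(1) that by (auto intro: analytic_on_subset simp flip: analytic_on_open)
    with False have "?q analytic_on {z}"
      by (intro analytic_intros) auto
    with False show ?thesis by simp
  qed
qed

text \<open>Every point of \<open>S\<close> has a punctured neighbourhood free of zeros of
  \<open>d\<close>, so the inequality passes to the limit there.\<close>

lemma nonneg_off_zeros_imp_nonneg:
  fixes \<phi> :: "complex \<Rightarrow> real"
  assumes S: "open S" "connected S" and d: "d holomorphic_on S" "a \<in> S" "d a \<noteq> 0"
    and cont: "continuous_on S \<phi>" and nonneg: "\<And>z. z \<in> S \<Longrightarrow> d z \<noteq> 0 \<Longrightarrow> 0 \<le> \<phi> z"
    and z: "z \<in> S"
  shows "0 \<le> \<phi> z"
proof (rule tendsto_lowerbound)
  show "\<phi> \<midarrow>z\<rightarrow> \<phi> z"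
    using cont S(1) z by (simp add: continuous_on_eq_continuous_at isCont_def)
  show "\<forall>\<^sub>F w in at z. 0 \<le> \<phi> w"
    using non_zero_neighbour_alt[OF d(1) S z d(2,3)] by eventually_elim (use nonneg in auto)
qed simp

section \<open>Contractions on slices\<close>

lemma sum_sum_cnj_eq_norm_sq:
  fixes x :: "nat \<Rightarrow> complex"
  shows "(\<Sum>i<n. \<Sum>j<n. x i * cnj (x j)) = of_real ((cmod (\<Sum>i<n. x i))\<^sup>2)"
  unfolding complex_norm_square cnj_sum sum_product ..

text \<open>The right side minus the left side is \<open>1 - (cmod l)\<^sup>2\<close> times the
  quadratic form of \<open>M\<close> at the points \<open>(z i, l)\<close>: each of the other four
  terms in the definition of \<open>K_kernel\<close> has rank one, and its double sum collapses to a
  squared modulus.\<close>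

lemma slice_contraction:
  fixes c z :: "nat \<Rightarrow> complex"
  assumes M: "is_kernel bidisc M"
    and N: "\<And>p q. p \<in> bidisc \<Longrightarrow> q \<in> bidisc \<Longrightarrow> N p q = f p * cnj (f q)"
    and K: "\<And>p q. p \<in> bidisc \<Longrightarrow> q \<in> bidisc \<Longrightarrow> K_kernel N M p q = g p * cnj (g q)"
    and l: "l \<in> disc" and z: "\<And>i. i < n \<Longrightarrow> z i \<in> disc"
  shows "(cmod (\<Sum>i<n. c i * g (z i, l)))\<^sup>2 + (cmod (\<Sum>i<n. c i * f (z i, l)))\<^sup>2
       \<le> (cmod (\<Sum>i<n. c i))\<^sup>2 + (cmod (\<Sum>i<n. c i * (z i * f (z i, l))))\<^sup>2"
proof -
  define s where "s = (\<Sum>i<n. \<Sum>j<n. c i * cnj (c j) * M (z i, l) (z j, l))"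
  have "\<forall>i<n. (z i, l) \<in> bidisc"
    using z l by auto
  then have s: "s \<in> \<real>\<^sub>\<ge>\<^sub>0"
    using M[unfolded is_kernel_def, rule_format, of n "\<lambda>i. (z i, l)" c] unfolding s_def by simp
  have defect: "(1 - cnj l * l) * M (z i, l) (z j, l)
     = 1 + (z i * f (z i, l)) * cnj (z j * f (z j, l))
         - g (z i, l) * cnj (g (z j, l)) - f (z i, l) * cnj (f (z j, l))"
    if "i < n" "j < n" for i j
    using K[of "(z i, l)" "(z j, l)"] N[of "(z i, l)" "(z j, l)"] z[OF that(1)] z[OF that(2)] l
    by (auto simp: K_kernel_def algebra_simps)
  let ?D = "(cmod (\<Sum>i<n. c i))\<^sup>2 + (cmod (\<Sum>i<n. c i * (z i * f (z i, l))))\<^sup>2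
      - (cmod (\<Sum>i<n. c i * g (z i, l)))\<^sup>2 - (cmod (\<Sum>i<n. c i * f (z i, l)))\<^sup>2"
  have "(1 - cnj l * l) * s
      = (\<Sum>i<n. \<Sum>j<n. c i * cnj (c j) * ((1 - cnj l * l) * M (z i, l) (z j, l)))"
    unfolding s_def by (simp add: sum_distrib_left mult_ac)
  also have "\<dots> = (\<Sum>i<n. \<Sum>j<n. c i * cnj (c j)
      + (c i * (z i * f (z i, l))) * cnj (c j * (z j * f (z j, l)))
      - (c i * g (z i, l)) * cnj (c j * g (z j, l)) - (c i * f (z i, l)) * cnj (c j * f (z j, l)))"
    by (intro sum.cong refl, subst defect) (simp_all add: algebra_simps)
  also have "\<dots> = of_real ?D"
    unfolding sum_subtractf sum.distrib sum_sum_cnj_eq_norm_sq by simp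
  finally have eq: "(1 - cnj l * l) * s = of_real ?D" .
  have "(cmod l)\<^sup>2 \<le> 1"
    using l by (simp add: power_le_one)
  moreover have "1 - cnj l * l = of_real (1 - (cmod l)\<^sup>2)"
    by (simp only: of_real_diff complex_norm_square of_real_1 mult.commute)
  ultimately have "1 - cnj l * l \<in> \<real>\<^sub>\<ge>\<^sub>0"
    by (simp only: nonneg_Reals_of_real_iff diff_ge_0_iff_ge)
  then have "(1 - cnj l * l) * s \<in> \<real>\<^sub>\<ge>\<^sub>0"
    using s by (rule nonneg_Reals_mult_I)
  then show ?thesis
    unfolding eq nonneg_Reals_of_real_iff by simp
qed

lemma onorm_matrix_2_le_1:
  fixes A :: "complex^2^2"
  assumes "\<And>x y. (cmod (A$1$1 * x + A$1$2 * y))\<^sup>2 + (cmod (A$2$1 * x + A$2$2 * y))\<^sup>2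
      \<le> (cmod x)\<^sup>2 + (cmod y)\<^sup>2"
  shows "onorm (\<lambda>v. A *v v) \<le> 1"
proof (rule onorm_le)
  show "norm (A *v v) \<le> 1 * norm v" for v
    using assms[of "v$1" "v$2"]
    by (simp add: norm_vec_def L2_set_def sum_2 matrix_vector_mult_def)
qed

section \<open>Construction and verification of the Schur function\<close>

theorem theorem5p5:
  fixes N M :: kernel2
  assumes "(N, M) \<in> R11"
  shows "\<exists>f\<in>rkhs bidisc N. \<exists>g\<in>rkhs bidisc (K_kernel N M).
    (\<forall>z\<in>disc. \<forall>l\<in>disc. \<forall>w\<in>disc. \<forall>m\<in>disc.
       N (z, l) (w, m) = cnj (f (w, m)) * f (z, l) \<and>
       K_kernel N M (z, l) (w, m) = cnj (g (w, m)) * g (z, l)) \<and>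
    (\<exists>\<Xi>\<in>schur22. \<forall>z\<in>disc. \<forall>l\<in>disc.
       \<Xi> l *v vector [1, z * f (z, l)] = vector [g (z, l), f (z, l)])"
proof -
  from assms have M: "is_kernel bidisc M" and aN: "analytic_kernel N" "kernel_rank bidisc N = 1"
    and aK: "analytic_kernel (K_kernel N M)" "kernel_rank bidisc (K_kernel N M) = 1"
    by (auto simp: R11_def analytic_kernel_def)
  obtain f where f: "f \<in> rkhs bidisc N"
    and N: "\<And>p q. p \<in> bidisc \<Longrightarrow> q \<in> bidisc \<Longrightarrow> N p q = f p * cnj (f q)"
    and f_nz: "\<exists>p\<in>bidisc. f p \<noteq> 0"
    and f_hol1: "\<And>l. l \<in> disc \<Longrightarrow> (\<lambda>z. f (z, l)) holomorphic_on disc"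
    and f_hol: "\<And>z. z \<in> disc \<Longrightarrow> (\<lambda>l. f (z, l)) holomorphic_on disc"
    by (rule rank_1_analytic_kernel[OF aN]) blast
  obtain g where g: "g \<in> rkhs bidisc (K_kernel N M)"
    and K: "\<And>p q. p \<in> bidisc \<Longrightarrow> q \<in> bidisc \<Longrightarrow> K_kernel N M p q = g p * cnj (g q)"
    and g_hol: "\<And>z. z \<in> disc \<Longrightarrow> (\<lambda>l. g (z, l)) holomorphic_on disc"
    by (rule rank_1_analytic_kernel[OF aK]) blast

  \<comment> \<open>A point where \<open>f\<close> is nonzero may have first coordinate 0. The zeros
    of \<open>f\<close> on the slice through it are isolated, so a nonzero \<open>z0\<close> near 0
    also works.\<close>
  obtain z0 l0 where z0: "z0 \<in> disc" "z0 \<noteq> 0" and l0: "l0 \<in> disc" "f (z0, l0) \<noteq> 0"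
  proof -
    from f_nz obtain z1 l1 where 1: "z1 \<in> disc" "l1 \<in> disc" "f (z1, l1) \<noteq> 0"
      by blast
    have "\<forall>\<^sub>F z in at 0. f (z, l1) \<noteq> 0 \<and> z \<in> disc"
      using non_zero_neighbour_alt[OF f_hol1[OF 1(2)] open_ball connected_ball _ 1(1,3), of 0]
      by simp
    moreover have "\<forall>\<^sub>F z in at (0::complex). z \<noteq> 0"
      by (simp add: eventually_at_filter)
    ultimately have "\<forall>\<^sub>F z in at 0. f (z, l1) \<noteq> 0 \<and> z \<in> disc \<and> z \<noteq> 0"
      by eventually_elim auto
    from eventually_happens'[OF at_neq_bot this] obtain z
      where "f (z, l1) \<noteq> 0" "z \<in> disc" "z \<noteq> 0"
      by blast
    with 1 that show thesis by blast
  qed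
  \<comment> \<open>This is the determinant of the vectors \<open>(1, 0)\<close> and
    \<open>(1, z0 * f (z0, l))\<close>, the values of \<open>u\<close> at \<open>(0, l)\<close> and
    \<open>(z0, l)\<close>.\<close>
  define d where "d = (\<lambda>l. z0 * f (z0, l))"
  have d_hol: "d holomorphic_on disc"
    unfolding d_def by (intro holomorphic_intros f_hol z0)
  have d_nz: "d l0 \<noteq> 0"
    using z0 l0 by (simp add: d_def)

  \<comment> \<open>The slice contraction at the points 0, \<open>z0\<close>, \<open>z\<close> with
    weights \<open>x\<close>, \<open>y\<close>, \<open>t\<close>. The second component of
    \<open>u\<close> vanishes at 0, so \<open>x\<close> is absent from the last square.\<close>
  have contr: "(cmod (x * g (0, l) + y * g (z0, l) + t * g (z, l)))\<^sup>2
        + (cmod (x * f (0, l) + y * f (z0, l) + t * f (z, l)))\<^sup>2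
      \<le> (cmod (x + y + t))\<^sup>2 + (cmod (y * d l + t * (z * f (z, l))))\<^sup>2"
    if "l \<in> disc" "z \<in> disc" for x y t z l
  proof -
    have 3: "{..<3::nat} = {0, 1, 2}" by auto
    have "[0, z0, z] ! i \<in> disc" if "i < 3" for i
    proof -
      have "i = 0 \<or> i = 1 \<or> i = 2" using that by auto
      then show ?thesis using z0(1) \<open>z \<in> disc\<close> by auto
    qed
    from slice_contraction[where n = 3 and z = "\<lambda>i. [0, z0, z] ! i" and c = "\<lambda>i. [x, y, t] ! i",
        OF M N K that(1) this] show ?thesis
      by (simp add: 3 d_def add.assoc)
  qed

  have quot: "cmod (g (z0, l) - g (0, l)) \<le> cmod (d l)" "cmod (f (z0, l) - f (0, l)) \<le> cmod (d l)"
    if "l \<in> disc" for l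
  proof -
    \<comment> \<open>The weights -1 and 1 cancel the first component of \<open>u\<close> and leave
      \<open>(0, d l)\<close>.\<close>
    have "(cmod (g (z0, l) - g (0, l)))\<^sup>2 + (cmod (f (z0, l) - f (0, l)))\<^sup>2 \<le> (cmod (d l))\<^sup>2"
      using contr[OF that z0(1), of "-1" 1 0] by simp
    then have "(cmod (g (z0, l) - g (0, l)))\<^sup>2 \<le> (cmod (d l))\<^sup>2"
        "(cmod (f (z0, l) - f (0, l)))\<^sup>2 \<le> (cmod (d l))\<^sup>2"
      using zero_le_power2[of "cmod (g (z0, l) - g (0, l))"]
        zero_le_power2[of "cmod (f (z0, l) - f (0, l))"] by linarith+
    then show "cmod (g (z0, l) - g (0, l)) \<le> cmod (d l)" "cmod (f (z0, l) - f (0, l)) \<le> cmod (d l)"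
      by (auto intro: power2_le_imp_le)
  qed
  have g_diff: "(\<lambda>l. g (z0, l) - g (0, l)) holomorphic_on disc"
    using g_hol[of z0] g_hol[of 0] z0(1) by (intro holomorphic_intros) simp_all
  obtain hg where hg: "hg holomorphic_on disc" "\<And>l. l \<in> disc \<Longrightarrow> g (z0, l) - g (0, l) = d l * hg l"
    using bounded_quotient_holomorphic[OF open_ball connected_ball g_diff d_hol quot(1) l0(1) d_nz]
    by blast
  have f_diff: "(\<lambda>l. f (z0, l) - f (0, l)) holomorphic_on disc"
    using f_hol[of z0] f_hol[of 0] z0(1) by (intro holomorphic_intros) simp_all
  obtain hf where hf: "hf holomorphic_on disc" "\<And>l. l \<in> disc \<Longrightarrow> f (z0, l) - f (0, l) = d l * hf l"
    using bounded_quotient_holomorphic[OF open_ball connected_ball f_diff d_hol quot(2) l0(1) d_nz]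
    by blast
  \<comment> \<open>The columns are the images of the standard basis: \<open>u (0, l)\<close> is the
    first basis vector, and \<open>u (z0, l) - u (0, l)\<close> is \<open>d l\<close> times the
    second.\<close>
  define \<Xi> :: "complex \<Rightarrow> complex^2^2" where
    "\<Xi> = (\<lambda>l. vector [vector [g (0, l), hg l], vector [f (0, l), hf l]])"
  have \<Xi>: "\<Xi> l $ 1 $ 1 = g (0, l)" "\<Xi> l $ 1 $ 2 = hg l" "\<Xi> l $ 2 $ 1 = f (0, l)" "\<Xi> l $ 2 $ 2 = hf l" for l
    by (simp_all add: \<Xi>_def)
  have cont: "continuous_on disc hg" "continuous_on disc hf"
    "\<And>z. z \<in> disc \<Longrightarrow> continuous_on disc (\<lambda>l. f (z, l))"
    "\<And>z. z \<in> disc \<Longrightarrow> continuous_on disc (\<lambda>l. g (z, l))"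
    using hg(1) hf(1) f_hol g_hol by (auto intro!: holomorphic_on_imp_continuous_on)
  note closed = nonneg_off_zeros_imp_nonneg[OF open_ball connected_ball d_hol l0(1) d_nz]

  have "(cmod (g (0, l) * x + hg l * y))\<^sup>2 + (cmod (f (0, l) * x + hf l * y))\<^sup>2
      \<le> (cmod x)\<^sup>2 + (cmod y)\<^sup>2" if l: "l \<in> disc" for x y l
  proof -
    define E where "E = (\<lambda>l. (cmod x)\<^sup>2 + (cmod y)\<^sup>2
        - ((cmod (g (0, l) * x + hg l * y))\<^sup>2 + (cmod (f (0, l) * x + hf l * y))\<^sup>2))"
    have "0 \<le> E l"
    proof (rule closed[where \<phi> = E, OF _ _ l])
      fix l assume l: "l \<in> disc" and nz: "d l \<noteq> 0"
      \<comment> \<open>The weights \<open>x - y / d l\<close> and \<open>y / d l\<close> express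
        \<open>(x, y)\<close> in the basis \<open>u (0, l)\<close>,
        \<open>u (z0, l)\<close>.\<close>
      have "(x - y / d l) * g (0, l) + y / d l * g (z0, l) = x * g (0, l) + y / d l * (g (z0, l) - g (0, l))"
        by (simp add: algebra_simps)
      moreover have "(x - y / d l) * f (0, l) + y / d l * f (z0, l) = x * f (0, l) + y / d l * (f (z0, l) - f (0, l))"
        by (simp add: algebra_simps)
      ultimately show "0 \<le> E l"
        using contr[OF l z0(1), of "x - y / d l" "y / d l" 0] nz
        by (simp add: E_def hg(2)[OF l] hf(2)[OF l] mult.commute)
    qed (unfold E_def, intro continuous_intros cont; simp)
    then show ?thesis by (simp add: E_def)
  qed
  then have "onorm (\<lambda>v. \<Xi> l *v v) \<le> 1" if "l \<in> disc" for l
    using that by (intro onorm_matrix_2_le_1) (simp add: \<Xi>)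
  moreover have "(\<lambda>l. \<Xi> l $ i $ j) holomorphic_on disc" for i j
    using exhaust_2[of i] exhaust_2[of j] f_hol[of 0] g_hol[of 0] hf(1) hg(1) by (auto simp: \<Xi>)
  ultimately have "\<Xi> \<in> schur22"
    by (simp add: schur22_def)
  moreover have "\<Xi> l *v vector [1, z * f (z, l)] = vector [g (z, l), f (z, l)]"
    if z: "z \<in> disc" and l: "l \<in> disc" for z l
  proof -
    define E where "E = (\<lambda>l. (cmod (g (0, l) + hg l * (z * f (z, l)) - g (z, l)))\<^sup>2
        + (cmod (f (0, l) + hf l * (z * f (z, l)) - f (z, l)))\<^sup>2)"
    \<comment> \<open>Vanishing of \<open>E\<close> passes to the zeros of \<open>d\<close> as the
      inequality \<open>E \<le> 0\<close>, since \<open>E\<close> is a sum of squares.\<close>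
    have "0 \<le> - E l"
    proof (rule closed[where \<phi> = "\<lambda>l. - E l", OF _ _ l])
      fix l assume l: "l \<in> disc" and nz: "d l \<noteq> 0"
      \<comment> \<open>This \<open>t\<close> solves
        \<open>u (z, l) = (1 - t) u (0, l) + t u (z0, l)\<close>. With weights \<open>1 - t\<close>,
        \<open>t\<close>, \<open>-1\<close> the right side of \<open>contr\<close> is 0, which
        forces the corresponding relation among the values of \<open>v\<close>.\<close>
      define t where "t = z * f (z, l) / d l"
      have t: "z * f (z, l) = t * d l"
        using nz by (simp add: t_def)
      have "(1 - t) * g (0, l) + t * g (z0, l) = g (0, l) + t * (g (z0, l) - g (0, l))"
           "(1 - t) * f (0, l) + t * f (z0, l) = f (0, l) + t * (f (z0, l) - f (0, l))"
        by (simp_all add: algebra_simps)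
      moreover have "E l = (cmod (g (0, l) + t * (g (z0, l) - g (0, l)) - g (z, l)))\<^sup>2
          + (cmod (f (0, l) + t * (f (z0, l) - f (0, l)) - f (z, l)))\<^sup>2"
        unfolding E_def t hg(2)[OF l] hf(2)[OF l] by (simp add: mult_ac)
      ultimately show "0 \<le> - E l"
        using contr[OF l z, of "1 - t" t "-1"] by (simp add: t)
    qed (unfold E_def, intro continuous_intros cont z; simp)
    moreover have "0 \<le> E l" by (simp add: E_def)
    ultimately have "E l = 0" by simp
    then have "g (0, l) + hg l * (z * f (z, l)) = g (z, l)" "f (0, l) + hf l * (z * f (z, l)) = f (z, l)"
      by (simp_all add: E_def sum_power2_eq_zero_iff)
    then show ?thesis
      by (simp add: vec_eq_iff forall_2 matrix_vector_mult_def sum_2 \<Xi>)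
  qed
  moreover have "N (z, l) (w, m) = cnj (f (w, m)) * f (z, l) \<and>
       K_kernel N M (z, l) (w, m) = cnj (g (w, m)) * g (z, l)"
    if "z \<in> disc" "l \<in> disc" "w \<in> disc" "m \<in> disc" for z l w m
    using N[of "(z, l)" "(w, m)"] K[of "(z, l)" "(w, m)"] that by (simp add: mult.commute)
  ultimately show ?thesis
    using f g by blast
qed

end
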